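(* Let $X$ be a second countable $C^1$ manifold of dimension $d$ equipped with its volume measure $\mu$, and let $Y$ be a Polish space. Assume that $c:X\times Y\to\mathbb{R}$ is a measurable coupling that is differentiable with respect to the first variable and satisfies: (a) (twist condition) for $x\in X$ and $y_1,y_2\in Y$, $D_1c(x,y_1)=D_1c(x,y_2)$ implies $y_1=y_2$; (b) for each measurable map $f:X\to Y$ there exist $p>1$ and a function $\eta\in L^p_{loc}(X)$ such that $|D_1c(x,f(x))|\le|\eta(x)|$ for all $x\in X$. Then any graph measurable $c$-monotone map $T:\mathrm{Dom}(T)\subset X\to 2^Y\setminus\{\emptyset\}$ is single-valued on its domain up to a $\mu$-null set.
   Context: $D_1c$ denotes the differential of $c$ with respect to its first variable. A set-valued map $T:\mathrm{Dom}(T)\subset X\to 2^Y\setminus\{\emptyset\}$ is graph measurable if its graph $\{(x,y):x\in\mathrm{Dom}(T),\,y\in Tx\}$ is a measurable subset of $X\times Y$. It is $c$-monotone if $c(x_1,y_2)+c(x_2,y_1)\le c(x_1,y_1)+c(x_2,y_2)$ for all $(x_1,y_1),(x_2,y_2)$ in its graph. *)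

theory Defs
  imports "HOL-Analysis.Analysis"
begin

section \<open>$C^1$ manifolds\<close>

text \<open>A chart is its domain paired with a coordinate map; only the values of the map on the
  domain matter.  The dimension of the manifold is \<open>CARD('n)\<close>.\<close>

type_synonym ('x, 'n) chart = "'x set \<times> ('x \<Rightarrow> real ^ 'n)"

definition chart_inv :: "('x, 'n) chart \<Rightarrow> real ^ 'n \<Rightarrow> 'x" where
  "chart_inv \<kappa> = inv_into (fst \<kappa>) (snd \<kappa>)"

definition charts_at :: "('x, 'n) chart set \<Rightarrow> 'x \<Rightarrow> ('x, 'n) chart set" where
  "charts_at \<A> x = {\<kappa> \<in> \<A>. x \<in> fst \<kappa>}"

definition transition :: "('x, 'n) chart \<Rightarrow> ('x, 'n) chart \<Rightarrow> real ^ 'n \<Rightarrow> real ^ 'n" where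
  "transition \<kappa> \<iota> = snd \<iota> \<circ> chart_inv \<kappa>"

definition C1_on :: "'a::euclidean_space set \<Rightarrow> ('a \<Rightarrow> 'b::euclidean_space) \<Rightarrow> bool" where
  "C1_on S f \<longleftrightarrow>
    (\<exists>f' :: 'a \<Rightarrow> 'a \<Rightarrow>\<^sub>L 'b.
      (\<forall>z\<in>S. (f has_derivative blinfun_apply (f' z)) (at z)) \<and> continuous_on S f')"

text \<open>The Hausdorff property and second countability are type class constraints.\<close>

definition C1_atlas ::
    "('x::{second_countable_topology, t2_space}, 'n::finite) chart set \<Rightarrow> bool" where
  "C1_atlas \<A> \<longleftrightarrow>
    (\<forall>\<kappa>\<in>\<A>. open (fst \<kappa>) \<and> open (snd \<kappa> ` fst \<kappa>) \<and>
      homeomorphism (fst \<kappa>) (snd \<kappa> ` fst \<kappa>) (snd \<kappa>) (chart_inv \<kappa>)) \<and>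
    (\<Union>\<kappa>\<in>\<A>. fst \<kappa>) = UNIV \<and>
    (\<forall>\<kappa>\<in>\<A>. \<forall>\<iota>\<in>\<A>. C1_on (snd \<kappa> ` (fst \<kappa> \<inter> fst \<iota>)) (transition \<kappa> \<iota>))"


section \<open>Tangent vectors and the differential of a function\<close>

text \<open>A tangent vector at \<open>x\<close> is the family of its coordinate vectors in the charts around \<open>x\<close>,
  related by the derivatives of the transition maps.  (Derivations are no substitute: on a manifold
  that is only $C^1$ they form a larger space.)\<close>

type_synonym ('x, 'n) tangent = "('x, 'n) chart \<Rightarrow> real ^ 'n"

definition tangent_space :: "('x, 'n::finite) chart set \<Rightarrow> 'x \<Rightarrow> ('x, 'n) tangent set" where
  "tangent_space \<A> x =
    {v. (\<forall>\<kappa>\<in>charts_at \<A> x. \<forall>\<iota>\<in>charts_at \<A> x.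
            v \<iota> = frechet_derivative (transition \<kappa> \<iota>) (at (snd \<kappa> x)) (v \<kappa>)) \<and>
        (\<forall>\<kappa>. \<kappa> \<notin> charts_at \<A> x \<longrightarrow> v \<kappa> = 0)}"

text \<open>The tangent vector at \<open>x\<close> with coordinates \<open>a\<close> in the chart \<open>\<kappa>\<close>.\<close>

definition coord_vec ::
    "('x, 'n::finite) chart set \<Rightarrow> ('x, 'n) chart \<Rightarrow> 'x \<Rightarrow> real ^ 'n \<Rightarrow> ('x, 'n) tangent" where
  "coord_vec \<A> \<kappa> x a = (\<lambda>\<iota>. if \<iota> \<in> charts_at \<A> x
     then frechet_derivative (transition \<kappa> \<iota>) (at (snd \<kappa> x)) a else 0)"

definition differentiable_at ::
    "('x, 'n::finite) chart set \<Rightarrow> ('x \<Rightarrow> real) \<Rightarrow> 'x \<Rightarrow> bool" where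
  "differentiable_at \<A> h x \<longleftrightarrow>
    (\<forall>\<kappa>\<in>charts_at \<A> x. (h \<circ> chart_inv \<kappa>) differentiable (at (snd \<kappa> x)))"

text \<open>The differential at \<open>x\<close>, a functional on the tangent space (extended by 0).  The choice of
  the chart is immaterial, see lemma \<open>differential_eq\<close> below.\<close>

definition differential ::
    "('x, 'n::finite) chart set \<Rightarrow> ('x \<Rightarrow> real) \<Rightarrow> 'x \<Rightarrow> ('x, 'n) tangent \<Rightarrow> real" where
  "differential \<A> h x v =
    (if v \<in> tangent_space \<A> x
     then (let \<kappa> = (SOME \<kappa>. \<kappa> \<in> charts_at \<A> x)
           in frechet_derivative (h \<circ> chart_inv \<kappa>) (at (snd \<kappa> x)) (v \<kappa>))
     else 0)"

lemma differential_eq: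
  fixes \<A> :: "('x::{second_countable_topology, t2_space}, 'n::finite) chart set"
  assumes \<A>: "C1_atlas \<A>" and h: "differentiable_at \<A> h x"
    and v: "v \<in> tangent_space \<A> x" and \<kappa>: "\<kappa> \<in> charts_at \<A> x"
  shows "differential \<A> h x v = frechet_derivative (h \<circ> chart_inv \<kappa>) (at (snd \<kappa> x)) (v \<kappa>)"
proof -
  define \<iota> where "\<iota> = (SOME \<kappa>. \<kappa> \<in> charts_at \<A> x)"
  have \<iota>: "\<iota> \<in> charts_at \<A> x"
    unfolding \<iota>_def using \<kappa> by (rule someI)
  have mem: "\<kappa> \<in> \<A>" "\<iota> \<in> \<A>" "x \<in> fst \<kappa>" "x \<in> fst \<iota>"
    using \<kappa> \<iota> by (auto simp: charts_at_def)
  have opn: "open (fst \<iota>)" "open (snd \<kappa> ` fst \<kappa>)"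
    and hom: "homeomorphism (fst \<kappa>) (snd \<kappa> ` fst \<kappa>) (snd \<kappa>) (chart_inv \<kappa>)"
    and hom': "homeomorphism (fst \<iota>) (snd \<iota> ` fst \<iota>) (snd \<iota>) (chart_inv \<iota>)"
    and C1: "C1_on (snd \<kappa> ` (fst \<kappa> \<inter> fst \<iota>)) (transition \<kappa> \<iota>)"
    using \<A> mem(1,2) unfolding C1_atlas_def by simp_all
  let ?z = "snd \<kappa> x"
  have inv: "chart_inv \<kappa> ?z = x"
    using homeomorphism_apply1[OF hom mem(3)] .
  have dt: "transition \<kappa> \<iota> differentiable (at ?z)"
    using C1 mem unfolding C1_on_def differentiable_def by blast
  have dh: "(h \<circ> chart_inv \<iota>) differentiable (at (transition \<kappa> \<iota> ?z))"
    using h \<iota> by (simp add: differentiable_at_def transition_def inv)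
  have "((h \<circ> chart_inv \<iota>) \<circ> transition \<kappa> \<iota> has_derivative
      frechet_derivative (h \<circ> chart_inv \<iota>) (at (transition \<kappa> \<iota> ?z)) \<circ>
      frechet_derivative (transition \<kappa> \<iota>) (at ?z)) (at ?z)"
    using dt dh unfolding frechet_derivative_works by (rule diff_chain_at)
  moreover have "open (chart_inv \<kappa> -` fst \<iota> \<inter> snd \<kappa> ` fst \<kappa>)"
    using continuous_on_open_vimage[OF opn(2)] homeomorphism_cont2[OF hom] opn(1) by blast
  moreover have "?z \<in> chart_inv \<kappa> -` fst \<iota> \<inter> snd \<kappa> ` fst \<kappa>"
    using mem inv by auto
  moreover have "((h \<circ> chart_inv \<iota>) \<circ> transition \<kappa> \<iota>) z = (h \<circ> chart_inv \<kappa>) z"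
    if "z \<in> chart_inv \<kappa> -` fst \<iota> \<inter> snd \<kappa> ` fst \<kappa>" for z
    using that by (simp add: transition_def homeomorphism_apply1[OF hom'])
  ultimately have "(h \<circ> chart_inv \<kappa> has_derivative
      frechet_derivative (h \<circ> chart_inv \<iota>) (at (transition \<kappa> \<iota> ?z)) \<circ>
      frechet_derivative (transition \<kappa> \<iota>) (at ?z)) (at ?z)"
    by (rule has_derivative_transform_within_open)
  from frechet_derivative_at[OF this]
  have "frechet_derivative (h \<circ> chart_inv \<kappa>) (at ?z) (v \<kappa>) =
      frechet_derivative (h \<circ> chart_inv \<iota>) (at (snd \<iota> x))
        (frechet_derivative (transition \<kappa> \<iota>) (at ?z) (v \<kappa>))"
    by (metis comp_apply inv transition_def)
  also have "frechet_derivative (transition \<kappa> \<iota>) (at ?z) (v \<kappa>) = v \<iota>"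
    using bspec[OF bspec[OF conjunct1[OF v[unfolded tangent_space_def mem_Collect_eq]] \<kappa>] \<iota>]
    by (rule sym)
  finally show ?thesis
    using v unfolding differential_def \<iota>_def Let_def by (simp only: if_True)
qed


section \<open>Riemannian metric, dual norm and volume measure\<close>

definition metric_matrix ::
    "('x, 'n::finite) chart set \<Rightarrow> ('x \<Rightarrow> ('x, 'n) tangent \<Rightarrow> ('x, 'n) tangent \<Rightarrow> real)
      \<Rightarrow> ('x, 'n) chart \<Rightarrow> 'x \<Rightarrow> real ^ 'n ^ 'n" where
  "metric_matrix \<A> g \<kappa> x =
    (\<chi> i j. g x (coord_vec \<A> \<kappa> x (axis i 1)) (coord_vec \<A> \<kappa> x (axis j 1)))"

text \<open>On a $C^1$ manifold the tangent bundle is only a $C^0$ bundle, so continuity is all the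
  regularity that a metric can have.\<close>

definition riemannian_metric ::
    "('x::topological_space, 'n::finite) chart set
      \<Rightarrow> ('x \<Rightarrow> ('x, 'n) tangent \<Rightarrow> ('x, 'n) tangent \<Rightarrow> real) \<Rightarrow> bool" where
  "riemannian_metric \<A> g \<longleftrightarrow>
    (\<forall>x. \<forall>v\<in>tangent_space \<A> x. \<forall>w\<in>tangent_space \<A> x. g x v w = g x w v) \<and>
    (\<forall>x. \<forall>\<kappa>\<in>charts_at \<A> x.
       bilinear (\<lambda>a b. g x (coord_vec \<A> \<kappa> x a) (coord_vec \<A> \<kappa> x b)) \<and>
       (\<forall>a. a \<noteq> 0 \<longrightarrow> 0 < g x (coord_vec \<A> \<kappa> x a) (coord_vec \<A> \<kappa> x a))) \<and>
    (\<forall>\<kappa>\<in>\<A>. continuous_on (fst \<kappa>) (metric_matrix \<A> g \<kappa>))"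

definition covector_norm ::
    "('x, 'n::finite) chart set \<Rightarrow> ('x \<Rightarrow> ('x, 'n) tangent \<Rightarrow> ('x, 'n) tangent \<Rightarrow> real)
      \<Rightarrow> 'x \<Rightarrow> (('x, 'n) tangent \<Rightarrow> real) \<Rightarrow> real" where
  "covector_norm \<A> g x \<omega> = (SUP v\<in>{v \<in> tangent_space \<A> x. g x v v \<le> 1}. \<bar>\<omega> v\<bar>)"

text \<open>\<open>\<mu>\<close> is the Borel measure with density $\sqrt{\det (g_{ij})}$ with respect to Lebesgue measure
  in every chart; by second countability this determines it.\<close>

definition volume_measure ::
    "('x::topological_space, 'n::finite) chart set
      \<Rightarrow> ('x \<Rightarrow> ('x, 'n) tangent \<Rightarrow> ('x, 'n) tangent \<Rightarrow> real) \<Rightarrow> 'x measure \<Rightarrow> bool" where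
  "volume_measure \<A> g \<mu> \<longleftrightarrow>
    sets \<mu> = sets borel \<and>
    (\<forall>\<kappa>\<in>\<A>. \<forall>B\<in>sets borel. B \<subseteq> fst \<kappa> \<longrightarrow>
       emeasure \<mu> B =
         (\<integral>\<^sup>+z\<in>snd \<kappa> ` B. ennreal (sqrt (det (metric_matrix \<A> g \<kappa> (chart_inv \<kappa> z)))) \<partial>lborel))"

definition locally_Lp :: "'x::topological_space measure \<Rightarrow> real \<Rightarrow> ('x \<Rightarrow> real) \<Rightarrow> bool" where
  "locally_Lp M p \<eta> \<longleftrightarrow>
    \<eta> \<in> borel_measurable M \<and>
    (\<forall>K. compact K \<longrightarrow> (\<integral>\<^sup>+x\<in>K. ennreal (\<bar>\<eta> x\<bar> powr p) \<partial>M) < \<infinity>)"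


section \<open>Set-valued maps\<close>

text \<open>A set-valued map is given by its domain \<open>D\<close> and its values; values off \<open>D\<close> are irrelevant.\<close>

definition graph_of :: "'x set \<Rightarrow> ('x \<Rightarrow> 'y set) \<Rightarrow> ('x \<times> 'y) set" where
  "graph_of D T = {(x, y). x \<in> D \<and> y \<in> T x}"

definition graph_measurable :: "'x measure \<Rightarrow> 'y measure \<Rightarrow> 'x set \<Rightarrow> ('x \<Rightarrow> 'y set) \<Rightarrow> bool" where
  "graph_measurable M N D T \<longleftrightarrow> graph_of D T \<in> sets (M \<Otimes>\<^sub>M N)"

definition c_monotone :: "('x \<times> 'y \<Rightarrow> real) \<Rightarrow> 'x set \<Rightarrow> ('x \<Rightarrow> 'y set) \<Rightarrow> bool" where
  "c_monotone c D T \<longleftrightarrow>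
    (\<forall>(x1, y1)\<in>graph_of D T. \<forall>(x2, y2)\<in>graph_of D T.
       c (x1, y2) + c (x2, y1) \<le> c (x1, y1) + c (x2, y2))"

text \<open>$D_1 c(x, y)$\<close>

definition D1 ::
    "('x, 'n::finite) chart set \<Rightarrow> ('x \<times> 'y \<Rightarrow> real) \<Rightarrow> 'x \<Rightarrow> 'y \<Rightarrow> ('x, 'n) tangent \<Rightarrow> real" where
  "D1 \<A> c x y = differential \<A> (\<lambda>x'. c (x', y)) x"

end

theory Submission
  imports Defs
begin

text \<open>At a point \<open>x\<close> of multivaluedness choose two values of \<open>T\<close>; by the twist condition the gradients
  of \<open>c\<close> at \<open>x\<close> for these values differ.  In a chart, split the set of such points into countably many
  pieces on which both gradients are nearly constant, say \<open>a\<close> and \<open>b\<close>, and the first-order Taylor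
  estimate is uniform.  Monotonicity between two nearby points of a piece then forces their difference
  to be nearly orthogonal to \<open>a - b \<noteq> 0\<close>, so the piece is locally a Lipschitz graph over a hyperplane and
  has measure zero.\<close>

text \<open>A difference of two points of \<open>A\<close> has at most half its length along
  \<open>w\<close>, so the orthogonal projection \<open>P\<close> onto the hyperplane normal to
  \<open>w\<close> keeps at least half of it. Hence \<open>P\<close> is injective on
  \<open>A\<close> with 2-Lipschitz inverse, and \<open>A\<close> is a Lipschitz image of a subset
  of a null hyperplane.\<close>

lemma negligible_almost_orthogonal:
  fixes A :: "'a::euclidean_space set"
  assumes w: "w \<noteq> 0"
    and A: "\<And>x y. x \<in> A \<Longrightarrow> y \<in> A \<Longrightarrow> \<bar>w \<bullet> (y - x)\<bar> \<le> norm w * norm (y - x) / 2"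
  shows "negligible A"
proof -
  define P where "P x = x - ((w \<bullet> x) / (w \<bullet> w)) *\<^sub>R w" for x
  have P_diff: "P y - P x = P (y - x)" for x y
    by (simp add: P_def algebra_simps diff_divide_distrib)
  have orth: "w \<bullet> P x = 0" for x
    using w by (simp add: P_def inner_diff_right)
  have lip: "norm (y - x) \<le> 2 * norm (P y - P x)" if "x \<in> A" "y \<in> A" for x y
  proof -
    define h where "h = y - x"
    have "norm (((w \<bullet> h) / (w \<bullet> w)) *\<^sub>R w) = \<bar>w \<bullet> h\<bar> / norm w"
      using w by (simp add: dot_square_norm power2_eq_square)
    also have "\<dots> \<le> norm h / 2"
      using A[OF that] w by (simp add: h_def field_simps)
    finally have "norm (h - P h) \<le> norm h / 2"
      by (simp add: P_def)
    moreover have "norm h \<le> norm (P h) + norm (h - P h)"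
      by (metis add.commute diff_add_cancel norm_triangle_ineq)
    ultimately show ?thesis
      by (simp add: P_diff h_def)
  qed
  have inj: "inj_on P A"
  proof (rule inj_onI)
    fix x y assume "x \<in> A" "y \<in> A" "P x = P y"
    then show "x = y"
      using lip[of x y] by simp
  qed
  have "negligible (P ` A)"
    by (rule negligible_subset[OF negligible_hyperplane[of w 0]]) (use w orth in auto)
  then have "negligible (inv_into A P ` P ` A)"
  proof (rule negligible_locally_Lipschitz_image[OF order_refl])
    fix u assume "u \<in> P ` A"
    then have "norm (inv_into A P v - inv_into A P u) \<le> 2 * norm (v - u)" if "v \<in> P ` A" for v
      using that lip inj by auto
    then show "\<exists>U B. open U \<and> u \<in> U \<and>
        (\<forall>v\<in>P ` A \<inter> U. norm (inv_into A P v - inv_into A P u) \<le> B * norm (v - u))"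
      by (intro exI[of _ UNIV] exI[of _ 2]) auto
  qed
  then show ?thesis
    using inv_into_image_cancel[OF inj order_refl] by simp
qed

text \<open>Negligibility is a local property, and two points of a ball of radius
  \<open>r / 2\<close> are less than \<open>r\<close> apart.\<close>

lemma negligible_locally_almost_orthogonal:
  fixes A :: "'a::euclidean_space set"
  assumes w: "w \<noteq> 0" and r: "r > 0"
    and A: "\<And>x y. x \<in> A \<Longrightarrow> y \<in> A \<Longrightarrow> norm (y - x) < r \<Longrightarrow> \<bar>w \<bullet> (y - x)\<bar> \<le> norm w * norm (y - x) / 2"
  shows "negligible A"
proof (rule iffD2[OF locally_negligible_alt], rule ballI)
  fix a assume a: "a \<in> A"
  have "negligible (A \<inter> ball a (r / 2))"
  proof (rule negligible_almost_orthogonal[OF w])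
    fix x y assume "x \<in> A \<inter> ball a (r / 2)" "y \<in> A \<inter> ball a (r / 2)"
    moreover from this have "norm (y - x) < r"
      using dist_triangle_half_r[of a y r x] by (simp add: dist_commute dist_norm[symmetric])
    ultimately show "\<bar>w \<bullet> (y - x)\<bar> \<le> norm w * norm (y - x) / 2"
      using A by auto
  qed
  then show "\<exists>U. openin (top_of_set A) U \<and> a \<in> U \<and> negligible U"
    using a r by (intro exI[of _ "A \<inter> ball a (r / 2)"]) auto
qed

text \<open>The Euclidean core: \<phi> plays the role of \<open>c\<close> read in a chart,
  \<open>f\<close> and \<open>g\<close> select two values, and \<open>p\<close> and \<open>q\<close>
  are the corresponding gradients.\<close>

lemma negligible_monotone_distinct_gradients:
  fixes \<phi> :: "'a::euclidean_space \<Rightarrow> 'y \<Rightarrow> real"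
  assumes f: "\<And>x. x \<in> S \<Longrightarrow> ((\<lambda>z. \<phi> z (f x)) has_derivative (\<lambda>h. h \<bullet> p x)) (at x)"
    and g: "\<And>x. x \<in> S \<Longrightarrow> ((\<lambda>z. \<phi> z (g x)) has_derivative (\<lambda>h. h \<bullet> q x)) (at x)"
    and neq: "\<And>x. x \<in> S \<Longrightarrow> p x \<noteq> q x"
    and mono: "\<And>x z. x \<in> S \<Longrightarrow> z \<in> S \<Longrightarrow> \<phi> x (g z) + \<phi> z (f x) \<le> \<phi> x (f x) + \<phi> z (g z)"
  shows "negligible S"
proof -
  obtain Q :: "'a set" where Q: "countable Q" and dense: "\<And>U. open U \<Longrightarrow> U \<noteq> {} \<Longrightarrow> \<exists>d\<in>Q. d \<in> U"
    using countable_dense_setE by metis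
  have approx: "\<exists>a\<in>Q. norm (u - a) < e" if "e > 0" for u :: 'a and e
    using dense[of "ball u e"] that by (auto simp: dist_norm)
  define taylor where "taylor e r x y v \<longleftrightarrow>
      (\<forall>z. norm (z - x) < r \<longrightarrow> \<bar>\<phi> z y - \<phi> x y - (z - x) \<bullet> v\<bar> \<le> e * norm (z - x))" for e r x y v
  have taylor: "\<exists>N. taylor e (inverse (real (Suc N))) x y v"
    if deriv: "((\<lambda>z. \<phi> z y) has_derivative (\<lambda>h. h \<bullet> v)) (at x)" and e: "e > 0" for x y v e
  proof -
    obtain d where d: "d > 0"
      "\<And>z. norm (z - x) < d \<Longrightarrow> norm (\<phi> z y - \<phi> x y - (z - x) \<bullet> v) \<le> e * norm (z - x)"
      using deriv[unfolded has_derivative_at_alt, THEN conjunct2, rule_format, OF e] by auto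
    obtain N where "inverse (real (Suc N)) < d"
      using reals_Archimedean[OF d(1)] by auto
    then show ?thesis
      using d(2) unfolding taylor_def real_norm_def by (meson less_trans)
  qed
  \<comment> \<open>The points \<open>a\<close> and \<open>b\<close> come from a countable dense
    set, \<open>M\<close> fixes the tolerance and \<open>N\<close>, \<open>K\<close> the radii of
    the two Taylor estimates, so there are countably many pieces. The factor 8 is chosen because
    four errors of size \<open>e\<close> must stay below half of
    \<open>norm (a - b)\<close>.\<close>
  define E where "E = (\<lambda>(a, b, M, N, K). {x \<in> S. let e = inverse (real (Suc M)) in
      norm (a - b) \<ge> 8 * e \<and> norm (p x - a) < e \<and> norm (q x - b) < e \<and>
      taylor e (inverse (real (Suc N))) x (f x) (p x) \<and>
      taylor e (inverse (real (Suc K))) x (g x) (q x)})"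
  have cover: "S \<subseteq> (\<Union>i \<in> Q \<times> Q \<times> UNIV. E i)"
  proof
    fix x assume x: "x \<in> S"
    \<comment> \<open>Replacing \<open>p x\<close> by \<open>a\<close> and \<open>q x\<close> by
      \<open>b\<close> costs at most \<open>e\<close> each, so a gap of more than
      \<open>10 * e\<close> leaves the required \<open>8 * e\<close>.\<close>
    obtain M where M: "inverse (real (Suc M)) < norm (p x - q x) / 10"
      using reals_Archimedean[of "norm (p x - q x) / 10"] neq[OF x] by auto
    define e where "e = inverse (real (Suc M))"
    have e: "e > 0"
      by (simp add: e_def)
    obtain a b where ab: "a \<in> Q" "norm (p x - a) < e" "b \<in> Q" "norm (q x - b) < e"
      using approx[OF e] by meson
    have "norm (p x - q x) \<le> norm (p x - a) + norm (a - b) + norm (q x - b)"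
      using norm_triangle_ineq[of "p x - a + (a - b)" "b - q x"] norm_triangle_ineq[of "p x - a" "a - b"]
      by (simp add: norm_minus_commute)
    then have "norm (a - b) \<ge> 8 * e"
      using ab M unfolding e_def by linarith
    moreover obtain N K where "taylor e (inverse (real (Suc N))) x (f x) (p x)"
      "taylor e (inverse (real (Suc K))) x (g x) (q x)"
      using taylor f g x e by meson
    ultimately have "x \<in> E (a, b, M, N, K)"
      using x ab unfolding E_def by (simp add: e_def Let_def)
    then show "x \<in> (\<Union>i \<in> Q \<times> Q \<times> UNIV. E i)"
      using ab by blast
  qed
  have "negligible (E (a, b, M, N, K))" for a b M N K
  proof (cases "norm (a - b) \<ge> 8 * inverse (real (Suc M))")
    case False
    then have "E (a, b, M, N, K) = {}"
      by (auto simp: E_def Let_def)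
    then show ?thesis
      by simp
  next
    case True
    define e where "e = inverse (real (Suc M))"
    define r where "r = min (inverse (real (Suc N))) (inverse (real (Suc K)))"
    have e: "e > 0" "norm (a - b) \<ge> 8 * e" and r: "r > 0"
      using True by (auto simp: e_def r_def)
    \<comment> \<open>Monotonicity bounds the increment of \<open>\<phi> _ (f x)\<close> from
      \<open>x\<close> to \<open>z\<close> by that of \<open>\<phi> _ (g z)\<close>. Expanding the
      former at \<open>x\<close> and the latter at \<open>z\<close> compares \<open>p x\<close> with
      \<open>q z\<close>. The four errors are two Taylor remainders and the replacement of these
      gradients by \<open>a\<close> and \<open>b\<close>.\<close>
    have one_sided: "(z - x) \<bullet> (a - b) \<le> 4 * (e * norm (z - x))"
      if x: "x \<in> E (a, b, M, N, K)" and z: "z \<in> E (a, b, M, N, K)" and near: "norm (z - x) < r" for x z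
    proof -
      have close: "\<bar>h \<bullet> (u - v)\<bar> \<le> e * norm h" if "norm (u - v) < e" for h u v :: 'a
        using Cauchy_Schwarz_ineq2[of h "u - v"] mult_left_mono[of "norm (u - v)" e "norm h"] that
        by (simp add: mult.commute)
      have "\<bar>\<phi> z (f x) - \<phi> x (f x) - (z - x) \<bullet> p x\<bar> \<le> e * norm (z - x)"
        "\<bar>\<phi> x (g z) - \<phi> z (g z) - (x - z) \<bullet> q z\<bar> \<le> e * norm (z - x)"
        using x z near by (auto simp: E_def Let_def taylor_def e_def r_def norm_minus_commute)
      moreover have "\<bar>(z - x) \<bullet> (p x - a)\<bar> \<le> e * norm (z - x)" "\<bar>(z - x) \<bullet> (q z - b)\<bar> \<le> e * norm (z - x)"
        by (rule close, use x z in \<open>simp add: E_def Let_def e_def\<close>)+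
      moreover have "\<phi> x (g z) + \<phi> z (f x) \<le> \<phi> x (f x) + \<phi> z (g z)"
        using mono x z by (auto simp: E_def)
      ultimately show ?thesis
        unfolding inner_diff_left inner_diff_right by linarith
    qed
    show ?thesis
    proof (rule negligible_locally_almost_orthogonal[OF _ r])
      show "a - b \<noteq> 0"
        using e by auto
    next
      fix x z assume *: "x \<in> E (a, b, M, N, K)" "z \<in> E (a, b, M, N, K)" "norm (z - x) < r"
      \<comment> \<open>Exchanging \<open>x\<close> and \<open>z\<close> gives the opposite
        sign.\<close>
      have "\<bar>(z - x) \<bullet> (a - b)\<bar> \<le> 4 * (e * norm (z - x))"
        using one_sided[OF *] one_sided[OF *(2,1)] *(3)
        by (simp add: norm_minus_commute inner_diff_left inner_diff_right)
      also have "\<dots> \<le> norm (a - b) * norm (z - x) / 2"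
        using mult_right_mono[OF e(2), of "norm (z - x)"] by simp
      finally show "\<bar>(a - b) \<bullet> (z - x)\<bar> \<le> norm (a - b) * norm (z - x) / 2"
        by (simp add: inner_commute)
    qed
  qed
  then have "negligible (\<Union>i \<in> Q \<times> Q \<times> UNIV. E i)"
    using Q by (intro negligible_countable_Union) auto
  then show ?thesis
    using cover negligible_subset by blast
qed

text \<open>In a chart \<mu> has a density with respect to Lebesgue measure. A negligible image need
  not be Borel, so it is enclosed in a Borel null set, whose preimage in the chart domain is then
  Borel and \<mu>-null.\<close>

lemma chart_preimage_null_set:
  fixes \<A> :: "('x::{second_countable_topology, t2_space}, 'n::finite) chart set"
  assumes \<A>: "C1_atlas \<A>" "volume_measure \<A> g \<mu>" and \<kappa>: "\<kappa> \<in> \<A>"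
    and S: "S \<subseteq> fst \<kappa>" "negligible (snd \<kappa> ` S)"
  shows "\<exists>N \<in> null_sets \<mu>. S \<subseteq> N"
proof -
  have opn: "open (fst \<kappa>)" "open (snd \<kappa> ` fst \<kappa>)"
    and hom: "homeomorphism (fst \<kappa>) (snd \<kappa> ` fst \<kappa>) (snd \<kappa>) (chart_inv \<kappa>)"
    using \<A>(1) \<kappa> unfolding C1_atlas_def by simp_all
  obtain N where N: "N \<in> null_sets lborel" "snd \<kappa> ` S \<subseteq> N"
    using S(2) unfolding negligible_iff_null_sets null_sets_completion_iff2 by blast
  define B where "B = snd \<kappa> -` N \<inter> fst \<kappa>"
  have "snd \<kappa> \<in> borel_measurable (restrict_space borel (fst \<kappa>))"
    using homeomorphism_cont1[OF hom] by (rule borel_measurable_continuous_on_restrict)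
  from measurable_sets[OF this, of N] have B: "B \<in> sets borel"
    using N(1) opn(1) by (auto simp: B_def space_restrict_space sets_restrict_space_iff)
  have "snd \<kappa> ` B = N \<inter> snd \<kappa> ` fst \<kappa>"
    by (auto simp: B_def)
  then have "snd \<kappa> ` B \<in> null_sets lborel"
    using N(1) opn(2) by (auto intro: null_set_Int2)
  then have "emeasure \<mu> B = 0"
    using \<A>(2) \<kappa> B unfolding volume_measure_def
    by (auto simp: B_def nn_integral_null_set)
  moreover have "B \<in> sets \<mu>"
    using B \<A>(2) by (simp add: volume_measure_def)
  moreover have "S \<subseteq> B"
    using S(1) N(2) by (auto simp: B_def)
  ultimately show ?thesis
    by blast
qed

theorem theorem1p2:
  fixes \<A> :: "('x::{second_countable_topology, t2_space}, 'n::finite) chart set"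
    and g :: "'x \<Rightarrow> ('x, 'n) tangent \<Rightarrow> ('x, 'n) tangent \<Rightarrow> real"
    and \<mu> :: "'x measure"
    and c :: "'x \<times> 'y::polish_space \<Rightarrow> real"
    and D :: "'x set" and T :: "'x \<Rightarrow> 'y set"
  assumes manifold: "C1_atlas \<A>" "riemannian_metric \<A> g" "volume_measure \<A> g \<mu>"
    and c_measurable: "c \<in> borel_measurable (completion \<mu> \<Otimes>\<^sub>M borel)"
    and c_differentiable: "\<And>x y. differentiable_at \<A> (\<lambda>x'. c (x', y)) x"
    and twist: "\<And>x y1 y2. D1 \<A> c x y1 = D1 \<A> c x y2 \<Longrightarrow> y1 = y2"
    and bound: "\<And>f. f \<in> completion \<mu> \<rightarrow>\<^sub>M borel \<Longrightarrow>
      \<exists>p>1. \<exists>\<eta>. locally_Lp (completion \<mu>) p \<eta> \<and>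
        (\<forall>x. covector_norm \<A> g x (D1 \<A> c x (f x)) \<le> \<bar>\<eta> x\<bar>)"
    and T_nonempty: "\<And>x. x \<in> D \<Longrightarrow> T x \<noteq> {}"
    and T_measurable: "graph_measurable (completion \<mu>) borel D T"
    and T_monotone: "c_monotone c D T"
  shows "AE x in \<mu>. x \<in> D \<longrightarrow> (\<exists>!y. y \<in> T x)"
proof -
  define S where "S = {x \<in> D. \<not> (\<exists>!y. y \<in> T x)}"
  have "\<exists>y1 y2. y1 \<in> T x \<and> y2 \<in> T x \<and> y1 \<noteq> y2" if x: "x \<in> S" for x
  proof -
    obtain y1 where "y1 \<in> T x"
      using T_nonempty[of x] x by (auto simp: S_def)
    then show ?thesis
      using x unfolding S_def by blast
  qed
  \<comment> \<open>Values of \<open>T\<close> are nonempty, so failure of uniqueness yields two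
    distinct ones; they are selected by choice.\<close>
  then obtain f h where fh: "\<And>x. x \<in> S \<Longrightarrow> f x \<in> T x \<and> h x \<in> T x \<and> f x \<noteq> h x"
    by metis
  have mono: "c (x, h z) + c (z, f x) \<le> c (x, f x) + c (z, h z)" if "x \<in> S" "z \<in> S" for x z
    using bspec[OF T_monotone[unfolded c_monotone_def], of "(x, f x)"] fh that
    by (simp add: graph_of_def S_def)
  have local: "\<exists>N \<in> null_sets \<mu>. S \<inter> fst \<kappa> \<subseteq> N" if \<kappa>: "\<kappa> \<in> \<A>" for \<kappa>
  proof (rule chart_preimage_null_set[OF manifold(1,3) \<kappa>])
    have hom: "homeomorphism (fst \<kappa>) (snd \<kappa> ` fst \<kappa>) (snd \<kappa>) (chart_inv \<kappa>)"
      using manifold(1) \<kappa> unfolding C1_atlas_def by simp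
    have inv [simp]: "chart_inv \<kappa> (snd \<kappa> x) = x" if "x \<in> fst \<kappa>" for x
      using homeomorphism_apply1[OF hom that] .
    define \<phi> where "\<phi> z y = c (chart_inv \<kappa> z, y)" for z y
    \<comment> \<open>The gradient in coordinates: the adjoint of a linear functional, evaluated at
      1, is its Riesz vector.\<close>
    define G where "G z y = adjoint (frechet_derivative (\<lambda>z. \<phi> z y) (at z)) 1" for z y
    have deriv: "((\<lambda>z. \<phi> z y) has_derivative frechet_derivative (\<lambda>z. \<phi> z y) (at (snd \<kappa> x))) (at (snd \<kappa> x))"
      if "x \<in> fst \<kappa>" for x y
      using bspec[OF c_differentiable[of y x, unfolded differentiable_at_def], of \<kappa>] that \<kappa>
      unfolding frechet_derivative_works[symmetric] by (simp add: charts_at_def \<phi>_def comp_def)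
    have grad: "frechet_derivative (\<lambda>z. \<phi> z y) (at (snd \<kappa> x)) = (\<lambda>u. u \<bullet> G (snd \<kappa> x) y)"
      if "x \<in> fst \<kappa>" for x y
      using adjoint_works[OF has_derivative_linear[OF deriv[OF that]]] by (simp add: G_def fun_eq_iff)
    have grad_deriv: "((\<lambda>z. \<phi> z y) has_derivative (\<lambda>u. u \<bullet> G (snd \<kappa> x) y)) (at (snd \<kappa> x))"
      if "x \<in> fst \<kappa>" for x y
      using deriv[OF that] by (simp add: grad[OF that])
    have inj: "y1 = y2" if x: "x \<in> fst \<kappa>" and eq: "G (snd \<kappa> x) y1 = G (snd \<kappa> x) y2" for x y1 y2
    proof (rule twist)
      \<comment> \<open>Off the tangent space the differential is 0 by convention, so the coordinate
        gradient determines \<open>D1\<close> as a total function, as \<open>twist\<close>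
        requires.\<close>
      have "D1 \<A> c x y v = (if v \<in> tangent_space \<A> x then v \<kappa> \<bullet> G (snd \<kappa> x) y else 0)" for y v
        using differential_eq[OF manifold(1) c_differentiable, of v x \<kappa> y] x \<kappa> grad[OF x, of y]
        by (cases "v \<in> tangent_space \<A> x") (simp_all add: D1_def charts_at_def \<phi>_def comp_def differential_def)
      then show "D1 \<A> c x y1 = D1 \<A> c x y2"
        using eq by (simp add: fun_eq_iff)
    qed
    have neq: "G (snd \<kappa> x) (f x) \<noteq> G (snd \<kappa> x) (h x)" if "x \<in> S" "x \<in> fst \<kappa>" for x
      using inj[OF that(2), of "f x" "h x"] fh[OF that(1)] by auto
    show "negligible (snd \<kappa> ` (S \<inter> fst \<kappa>))"
    proof (rule negligible_monotone_distinct_gradients[where \<phi> = \<phi>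
          and f = "f \<circ> chart_inv \<kappa>" and p = "\<lambda>z. G z (f (chart_inv \<kappa> z))"
          and g = "h \<circ> chart_inv \<kappa>" and q = "\<lambda>z. G z (h (chart_inv \<kappa> z))"])
      fix u v assume "u \<in> snd \<kappa> ` (S \<inter> fst \<kappa>)" "v \<in> snd \<kappa> ` (S \<inter> fst \<kappa>)"
      then show "\<phi> u ((h \<circ> chart_inv \<kappa>) v) + \<phi> v ((f \<circ> chart_inv \<kappa>) u)
          \<le> \<phi> u ((f \<circ> chart_inv \<kappa>) u) + \<phi> v ((h \<circ> chart_inv \<kappa>) v)"
        using mono fh by (auto simp: \<phi>_def)
    qed (auto simp: grad_deriv neq)
  qed simp
  then obtain N where N: "\<And>\<kappa>. \<kappa> \<in> \<A> \<Longrightarrow> N \<kappa> \<in> null_sets \<mu> \<and> S \<inter> fst \<kappa> \<subseteq> N \<kappa>"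
    by metis
  \<comment> \<open>The atlas may be uncountable; second countability provides countably many charts
    that still cover, so the local null sets can be united.\<close>
  have "\<And>U. U \<in> fst ` \<A> \<Longrightarrow> open U" and cover: "\<Union>(fst ` \<A>) = UNIV"
    using manifold(1) unfolding C1_atlas_def by auto
  then obtain \<U> where "\<U> \<subseteq> fst ` \<A>" "countable \<U>" "\<Union>\<U> = UNIV"
    using Lindelof by metis
  then obtain \<B> where \<B>: "\<B> \<subseteq> \<A>" "countable \<B>" "\<Union>(fst ` \<B>) = UNIV"
    by (metis countable_subset_image)
  have "(\<Union>\<kappa>\<in>\<B>. N \<kappa>) \<in> null_sets \<mu>"
    using \<B> N by (intro null_sets_UN') auto
  moreover have "S \<subseteq> (\<Union>\<kappa>\<in>\<B>. N \<kappa>)"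
    using \<B> N by blast
  ultimately show ?thesis
    by (intro AE_I'[of "\<Union>\<kappa>\<in>\<B>. N \<kappa>"]) (auto simp: S_def)
qed

end
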